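(* Let $\sigma>0$ and $\beta>0$. Let $A:\mathcal{H}\to\mathcal{H}$ and $B:\mathcal{H}\to2^{\mathcal{H}}$ be maximally monotone, and let $A$ be $\sigma$-strongly monotone and $\beta$-Lipschitz continuous. Let $\gamma\in(0,\infty)$ and let the Douglas-Rachford algorithm $$z^{k+1}=\big((1-\alpha)\mathrm{Id}+\alpha R_{\gamma A}R_{\gamma B}\big)z^k$$ be applied to solve $0\in\gamma Ax+\gamma Bx$. Let $\delta=\sqrt{1-\frac{4\gamma\sigma}{1+2\gamma\sigma+(\gamma\beta)^2}}$. Then the algorithm converges at least with rate factor $$|1-\alpha|+\alpha\delta$$ for all $\alpha\in\big(0,\tfrac{2}{1+\delta}\big)$. Moreover, minimizing this bound with respect to $\alpha$ and $\gamma$ (over $\gamma\in(0,\infty)$ and $\alpha\in(0,\tfrac{2}{1+\delta})$) gives $\alpha=1$ and $\gamma=\tfrac1\beta$, and the corresponding optimal rate bound is $\sqrt{\frac{\beta/\sigma-1}{\beta/\sigma+1}}$.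
   Context: $\mathcal{H}$ is a separable real Hilbert space, $\mathcal{H}\ne\{0\}$ (so that necessarily $\sigma\le\beta$). An operator $A$ is $\sigma$-strongly monotone if $\langle u-v,x-y\rangle\ge\sigma\|x-y\|^2$ for all $u\in Ax$, $v\in Ay$. For a maximally monotone operator $M$, the resolvent is $J_M=(\mathrm{Id}+M)^{-1}$ and the reflected resolvent is $R_M=2J_M-\mathrm{Id}$; both are single-valued with full domain. The algorithm "converges at least with rate factor $\rho$" means that $\rho\in[0,1)$, that the iteration operator $T=(1-\alpha)\mathrm{Id}+\alpha R_{\gamma A}R_{\gamma B}$ has a unique fixed point $\bar z$, and that $\|z^{k+1}-\bar z\|\le\rho\|z^k-\bar z\|$ for all $k\geq 0$ and every starting point $z^0\in\mathcal{H}$. *)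

theory Defs
  imports "HOL-Analysis.Analysis"
begin

text \<open>Set-valued operators are functions of type \<open>'a \<Rightarrow> 'a set\<close>.  On them, \<open>M \<le> N\<close> is the
  pointwise order, that is, inclusion of graphs.\<close>

definition monotone_operator :: "('a::real_inner \<Rightarrow> 'a set) \<Rightarrow> bool" where
  "monotone_operator M \<longleftrightarrow> (\<forall>x y. \<forall>u\<in>M x. \<forall>v\<in>M y. (u - v) \<bullet> (x - y) \<ge> 0)"

definition maximally_monotone :: "('a::real_inner \<Rightarrow> 'a set) \<Rightarrow> bool" where
  "maximally_monotone M \<longleftrightarrow>
     monotone_operator M \<and> (\<forall>N. monotone_operator N \<and> M \<le> N \<longrightarrow> N = M)"

definition strongly_monotone :: "real \<Rightarrow> ('a::real_inner \<Rightarrow> 'a set) \<Rightarrow> bool" where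
  "strongly_monotone \<sigma> M \<longleftrightarrow>
     (\<forall>x y. \<forall>u\<in>M x. \<forall>v\<in>M y. (u - v) \<bullet> (x - y) \<ge> \<sigma> * (norm (x - y))\<^sup>2)"

definition single_op :: "('a \<Rightarrow> 'a) \<Rightarrow> 'a \<Rightarrow> 'a set" where
  "single_op F x = {F x}"

definition scale_op :: "real \<Rightarrow> ('a::real_vector \<Rightarrow> 'a set) \<Rightarrow> 'a \<Rightarrow> 'a set" where
  "scale_op \<gamma> M x = (\<lambda>u. \<gamma> *\<^sub>R u) ` M x"

definition id_plus_op :: "('a::plus \<Rightarrow> 'a set) \<Rightarrow> 'a \<Rightarrow> 'a set" where
  "id_plus_op M x = (\<lambda>u. x + u) ` M x"

definition inverse_op :: "('a \<Rightarrow> 'a set) \<Rightarrow> 'a \<Rightarrow> 'a set" where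
  "inverse_op M y = {x. y \<in> M x}"

text \<open>The description operator reads the set-valued \<open>(Id + M)\<^sup>-\<^sup>1\<close> as a function.  This is
  meaningful when every value is a singleton, as for maximally monotone \<open>M\<close> on a Hilbert
  space (Minty's theorem).\<close>

definition resolvent :: "('a::real_inner \<Rightarrow> 'a set) \<Rightarrow> 'a \<Rightarrow> 'a" where
  "resolvent M x = (THE p. p \<in> inverse_op (id_plus_op M) x)"

definition reflected_resolvent :: "('a::real_inner \<Rightarrow> 'a set) \<Rightarrow> 'a \<Rightarrow> 'a" where
  "reflected_resolvent M x = 2 *\<^sub>R resolvent M x - x"

definition douglas_rachford ::
    "real \<Rightarrow> real \<Rightarrow> ('a::real_inner \<Rightarrow> 'a set) \<Rightarrow> ('a \<Rightarrow> 'a set) \<Rightarrow> 'a \<Rightarrow> 'a" where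
  "douglas_rachford \<alpha> \<gamma> A B z =
     (1 - \<alpha>) *\<^sub>R z
       + \<alpha> *\<^sub>R reflected_resolvent (scale_op \<gamma> A) (reflected_resolvent (scale_op \<gamma> B) z)"

definition converges_with_rate :: "('a::real_normed_vector \<Rightarrow> 'a) \<Rightarrow> real \<Rightarrow> bool" where
  "converges_with_rate T \<rho> \<longleftrightarrow>
     0 \<le> \<rho> \<and> \<rho> < 1 \<and> (\<exists>!zbar. T zbar = zbar) \<and>
     (\<forall>zbar. T zbar = zbar \<longrightarrow>
        (\<forall>z :: nat \<Rightarrow> 'a. (\<forall>k. z (Suc k) = T (z k)) \<longrightarrow>
           (\<forall>k. norm (z (Suc k) - zbar) \<le> \<rho> * norm (z k - zbar))))"

definition dr_delta :: "real \<Rightarrow> real \<Rightarrow> real \<Rightarrow> real" where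
  "dr_delta \<sigma> \<beta> \<gamma> = sqrt (1 - 4 * \<gamma> * \<sigma> / (1 + 2 * \<gamma> * \<sigma> + (\<gamma> * \<beta>)\<^sup>2))"

definition dr_rate_bound :: "real \<Rightarrow> real \<Rightarrow> real \<Rightarrow> real \<Rightarrow> real" where
  "dr_rate_bound \<sigma> \<beta> \<alpha> \<gamma> = \<bar>1 - \<alpha>\<bar> + \<alpha> * dr_delta \<sigma> \<beta> \<gamma>"

end

theory Submission
  imports Defs
begin

text \<open>
  Apart from the existence of resolvents, the rate is a computation with inner products.  If
  \<open>p\<close> and \<open>u\<close> are the differences of two points of the graph of \<open>\<gamma>A\<close>, then the differences
  of the corresponding arguments and values of the reflected resolvent are \<open>p + u\<close> and
  \<open>p - u\<close>.  Since \<open>p \<bullet> u \<ge> \<gamma>\<sigma>\<parallel>p\<parallel>\<^sup>2\<close> and \<open>\<parallel>u\<parallel> \<le> \<gamma>\<beta>\<parallel>p\<parallel>\<close>, the quotient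
  \<open>\<parallel>p - u\<parallel>\<^sup>2 / \<parallel>p + u\<parallel>\<^sup>2 = 1 - 4 p \<bullet> u / (\<parallel>p\<parallel>\<^sup>2 + 2 p \<bullet> u + \<parallel>u\<parallel>\<^sup>2)\<close> is at most \<open>\<delta>\<^sup>2\<close> if \<open>p + u \<noteq> 0\<close>
  (\<open>norm_diff_le_delta_norm_add\<close>).  The reflected resolvent of \<open>\<gamma>B\<close> is nonexpansive, so the
  Douglas-Rachford operator is Lipschitz with constant \<open>\<bar>1 - \<alpha>\<bar> + \<alpha>\<delta> < 1\<close>, and Banach's fixed
  point theorem applies.

  Resolvents are described by a definite description, so single-valuedness and full domain must
  be proved.  Full domain is Minty's theorem (\<open>minty_zero\<close>, \<open>minty_surjective\<close>).  The proof
  minimises \<open>\<parallel>x\<parallel>\<^sup>2/2 + \<parallel>v\<parallel>\<^sup>2/2 + \<phi>(x, v)\<close> over the product space, where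
  \<open>\<phi>(x, v) = sup {u \<bullet> x + y \<bullet> v - u \<bullet> y | u \<in> M y}\<close> is the Fitzpatrick function of the maximally
  monotone operator \<open>M\<close>.  Strong convexity and completeness give a minimiser, with no appeal to
  weak compactness.  Maximality gives \<open>\<phi>(x, v) \<ge> x \<bullet> v\<close>, which bounds the objective from
  below, and the first-order optimality condition shows that \<open>(- v, - x)\<close> belongs to the graph
  and that \<open>x + v = 0\<close>.

  For the optimal parameters, \<open>\<bar>1 - \<alpha>\<bar> + \<alpha>\<delta> \<ge> \<delta>\<close> with equality only for \<open>\<alpha> = 1\<close>, because
  \<open>0 \<le> \<delta> < 1\<close>; and \<open>\<delta>\<close> is minimal only for \<open>\<gamma>\<beta> = 1\<close>, because
  \<open>(1 - \<gamma>\<beta>)\<^sup>2 > 0\<close> otherwise.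
\<close>

section \<open>Minimisation of the squared norm over an epigraph\<close>

text \<open>
  The set \<open>C\<close> plays the part of the epigraph of a convex lower semicontinuous function \<open>f\<close>; this
  avoids extended real values.  The conclusion is the first-order optimality condition
  \<open>- p0 \<in> \<partial>f(p0)\<close> for a minimiser \<open>p0\<close> of \<open>\<parallel>p\<parallel>\<^sup>2/2 + f(p)\<close>.
\<close>

lemma epigraph_minimiser_exists:
  fixes C :: "('b::{real_inner, complete_space} \<times> real) set"
  assumes "closed C" and conv: "convex C" and "C \<noteq> {}"
    and lower: "\<And>p t. (p, t) \<in> C \<Longrightarrow> l \<le> (norm p)\<^sup>2 / 2 + t"
  obtains p0 t0 where "(p0, t0) \<in> C"
    and "\<And>p t. (p, t) \<in> C \<Longrightarrow> 0 \<le> p0 \<bullet> (p - p0) + (t - t0)"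
proof -
  define h where "h = (\<lambda>q :: 'b \<times> real. (norm (fst q))\<^sup>2 / 2 + snd q)"
  define m where "m = Inf (h ` C)"
  have bdd: "bdd_below (h ` C)"
    using lower by (intro bdd_belowI[of _ l]) (auto simp: h_def)
  have m_le: "m \<le> h q" if "q \<in> C" for q
    unfolding m_def using that bdd by (intro cInf_lower) auto
  have "\<exists>q\<in>C. h q < m + inverse (real (Suc n))" for n
  proof -
    have "Inf (h ` C) < m + inverse (real (Suc n))" by (simp add: m_def)
    then show ?thesis using \<open>C \<noteq> {}\<close> bdd by (subst (asm) cInf_less_iff) auto
  qed
  then obtain q where qC: "\<And>n. q n \<in> C" and qm: "\<And>n. h (q n) < m + inverse (real (Suc n))"
    by metis
  have h_lim: "(\<lambda>n. h (q n)) \<longlonglongrightarrow> m"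
  proof (rule tendsto_sandwich[where f = "\<lambda>_. m"])
    show "\<forall>\<^sub>F n in sequentially. m \<le> h (q n)" using m_le qC by simp
    show "\<forall>\<^sub>F n in sequentially. h (q n) \<le> m + inverse (real (Suc n))"
      using qm by (simp add: less_imp_le)
    show "(\<lambda>n. m + inverse (real (Suc n))) \<longlonglongrightarrow> m"
      using tendsto_add[OF tendsto_const LIMSEQ_inverse_real_of_nat, of m] by simp
  qed simp
  \<comment> \<open>strong convexity of the objective, at the midpoint of two members of the minimising
      sequence\<close>
  have gap: "(norm (fst (q i) - fst (q j)))\<^sup>2 \<le> 4 * (h (q i) - m) + 4 * (h (q j) - m)" for i j
  proof -
    have "(1/2) *\<^sub>R q i + (1/2) *\<^sub>R q j \<in> C"
      using convexD[OF conv qC qC, of "1/2" "1/2"] by simp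
    then have "m \<le> h ((1/2) *\<^sub>R q i + (1/2) *\<^sub>R q j)" by (rule m_le)
    also have "\<dots> = (h (q i) + h (q j)) / 2 - (norm (fst (q i) - fst (q j)))\<^sup>2 / 8"
      unfolding h_def power2_norm_eq_inner
      by (simp add: inner_simps inner_commute field_simps)
    finally show ?thesis by argo
  qed
  have "Cauchy (\<lambda>n. fst (q n))"
    unfolding Cauchy_def
  proof (intro allI impI)
    fix e :: real assume "e > 0"
    then have "m < m + e\<^sup>2 / 8" by simp
    then obtain N where N: "\<And>n. n \<ge> N \<Longrightarrow> h (q n) < m + e\<^sup>2 / 8"
      using order_tendstoD(2)[OF h_lim] unfolding eventually_sequentially by blast
    have "dist (fst (q i)) (fst (q j)) < e" if "i \<ge> N" "j \<ge> N" for i j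
    proof -
      have "(norm (fst (q i) - fst (q j)))\<^sup>2 < e\<^sup>2"
        using gap[of i j] N[OF that(1)] N[OF that(2)] by argo
      then show ?thesis using \<open>e > 0\<close> by (simp add: dist_norm power2_less_imp_less)
    qed
    then show "\<exists>N. \<forall>i\<ge>N. \<forall>j\<ge>N. dist (fst (q i)) (fst (q j)) < e" by blast
  qed
  then obtain p0 where p0: "(\<lambda>n. fst (q n)) \<longlonglongrightarrow> p0"
    using Cauchy_convergent convergent_def by blast
  define t0 where "t0 = m - (norm p0)\<^sup>2 / 2"
  have "(\<lambda>n. h (q n) - (norm (fst (q n)))\<^sup>2 / 2) \<longlonglongrightarrow> t0"
    unfolding t0_def by (intro tendsto_intros h_lim p0) auto
  then have "(\<lambda>n. snd (q n)) \<longlonglongrightarrow> t0" by (simp add: h_def)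
  from tendsto_Pair[OF p0 this] have "q \<longlonglongrightarrow> (p0, t0)" by simp
  then have q0C: "(p0, t0) \<in> C"
    using \<open>closed C\<close> qC closed_sequentially by blast
  have "0 \<le> p0 \<bullet> (p - p0) + (t - t0)" if "(p, t) \<in> C" for p t
  proof -
    let ?d = "p0 \<bullet> (p - p0) + (t - t0)"
    let ?e = "(norm (p - p0))\<^sup>2 / 2"
    \<comment> \<open>minimality along the segment towards \<open>(p, t)\<close>; the claim follows as \<open>s\<close> tends to 0\<close>
    have step: "0 \<le> ?d + s * ?e" if s: "0 < s" "s < 1" for s
    proof -
      have "(1 - s) *\<^sub>R (p0, t0) + s *\<^sub>R (p, t) \<in> C"
        using s by (intro convexD[OF conv q0C \<open>(p, t) \<in> C\<close>]) auto
      then have "m \<le> h ((1 - s) *\<^sub>R (p0, t0) + s *\<^sub>R (p, t))" by (rule m_le)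
      also have "\<dots> = m + s * (?d + s * ?e)"
      proof -
        have "(1 - s) *\<^sub>R p0 + s *\<^sub>R p = p0 + s *\<^sub>R (p - p0)" by (simp add: algebra_simps)
        moreover have "(norm (p0 + s *\<^sub>R (p - p0)))\<^sup>2
            = (norm p0)\<^sup>2 + 2 * s * (p0 \<bullet> (p - p0)) + s\<^sup>2 * (norm (p - p0))\<^sup>2"
          unfolding power2_norm_eq_inner
          by (simp add: inner_add inner_commute power2_eq_square)
        ultimately show ?thesis
          by (simp add: h_def t0_def field_simps power2_eq_square)
      qed
      finally show ?thesis using s by (simp add: zero_le_mult_iff)
    qed
    have "((\<lambda>s. ?d + s * ?e) \<longlongrightarrow> ?d + 0 * ?e) (at_right 0)"
      by (intro tendsto_intros)
    moreover have "\<forall>\<^sub>F s :: real in at_right 0. 0 \<le> ?d + s * ?e"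
      using step by (intro eventually_at_rightI[of 0 1]) auto
    ultimately show ?thesis
      using tendsto_lowerbound[of _ "?d + 0 * ?e" "at_right (0::real)" 0] by simp
  qed
  with q0C show ?thesis by (rule that)
qed

section \<open>Minty's theorem\<close>

text \<open>Maximality says that a pair monotonically related to the whole graph lies in the graph.\<close>

lemma maximally_monotone_iff:
  "maximally_monotone M \<longleftrightarrow> monotone_operator M \<and>
     (\<forall>x v. (\<forall>y. \<forall>u\<in>M y. 0 \<le> (u - v) \<bullet> (y - x)) \<longrightarrow> v \<in> M x)"
proof (intro iffI conjI allI impI)
  assume "maximally_monotone M"
  then show mono: "monotone_operator M" by (simp add: maximally_monotone_def)
  fix x v assume rel: "\<forall>y. \<forall>u\<in>M y. 0 \<le> (u - v) \<bullet> (y - x)"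
  let ?N = "M(x := insert v (M x))"
  have swap: "(v - u) \<bullet> (x - y) = (u - v) \<bullet> (y - x)" for u y
    by (simp add: inner_simps)
  have "monotone_operator ?N"
    using mono rel swap unfolding monotone_operator_def by (auto split: if_splits)
  moreover have "M \<le> ?N" by (auto simp: le_fun_def)
  ultimately have "?N = M"
    using \<open>maximally_monotone M\<close> by (simp add: maximally_monotone_def)
  then show "v \<in> M x" by (metis fun_upd_same insertI1)
next
  assume *: "monotone_operator M \<and>
     (\<forall>x v. (\<forall>y. \<forall>u\<in>M y. 0 \<le> (u - v) \<bullet> (y - x)) \<longrightarrow> v \<in> M x)"
  have "N = M" if N: "monotone_operator N" "M \<le> N" for N
  proof (rule antisym[OF _ N(2)])
    show "N \<le> M"
    proof (intro le_funI subsetI)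
      fix x v assume "v \<in> N x"
      then have "\<forall>y. \<forall>u\<in>M y. 0 \<le> (u - v) \<bullet> (y - x)"
        using N unfolding monotone_operator_def le_fun_def by blast
      with * show "v \<in> M x" by blast
    qed
  qed
  with * show "maximally_monotone M" by (simp add: maximally_monotone_def)
qed

lemma monotone_operatorD:
  "monotone_operator M \<Longrightarrow> u \<in> M x \<Longrightarrow> v \<in> M y \<Longrightarrow> 0 \<le> (u - v) \<bullet> (x - y)"
  by (auto simp: monotone_operator_def)

lemma maximally_monotone_imp_monotone:
  "maximally_monotone M \<Longrightarrow> monotone_operator M"
  by (simp add: maximally_monotone_def)

lemma maximally_monotone_memI:
  assumes "maximally_monotone M" "\<And>y u. u \<in> M y \<Longrightarrow> 0 \<le> (u - v) \<bullet> (y - x)"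
  shows "v \<in> M x"
  using assms by (auto simp: maximally_monotone_iff)

lemma minty_zero:
  fixes M :: "'a::{real_inner, complete_space} \<Rightarrow> 'a set"
  assumes M: "maximally_monotone M"
  shows "\<exists>x. - x \<in> M x"
proof -
  \<comment> \<open>the epigraph of the Fitzpatrick function\<close>
  define C :: "(('a \<times> 'a) \<times> real) set"
    where "C = {q. \<forall>y. \<forall>u\<in>M y. u \<bullet> fst (fst q) + y \<bullet> snd (fst q) - u \<bullet> y \<le> snd q}"
  have graph_C: "((x, v), v \<bullet> x) \<in> C" if "v \<in> M x" for x v
  proof -
    have "u \<bullet> x + y \<bullet> v - u \<bullet> y \<le> v \<bullet> x" if "u \<in> M y" for y u
      using monotone_operatorD[OF maximally_monotone_imp_monotone[OF M] that \<open>v \<in> M x\<close>]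
      by (simp add: inner_simps inner_commute)
    then show ?thesis by (simp add: C_def)
  qed
  have C_ge: "v \<bullet> x \<le> t" if "((x, v), t) \<in> C" for x v t
  proof (rule ccontr)
    assume less: "\<not> v \<bullet> x \<le> t"
    have C: "u \<bullet> x + y \<bullet> v - u \<bullet> y \<le> t" if "u \<in> M y" for y u
      using that \<open>((x, v), t) \<in> C\<close> by (auto simp: C_def)
    have "v \<in> M x"
    proof (rule maximally_monotone_memI[OF M])
      fix y u assume "u \<in> M y"
      then show "0 \<le> (u - v) \<bullet> (y - x)"
        using C[of u y] less by (simp add: inner_simps inner_commute)
    qed
    from C[OF this] less show False by (simp add: inner_commute)
  qed
  have "C = (\<Inter>(y, u)\<in>{(y, u). u \<in> M y}.
      {q. u \<bullet> fst (fst q) + y \<bullet> snd (fst q) - u \<bullet> y \<le> snd q})"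
    by (auto simp: C_def)
  moreover have "closed \<dots>"
    by (intro closed_INT ballI, clarify, intro closed_Collect_le continuous_intros)
  ultimately have "closed C" by simp
  moreover have "convex C"
  proof (rule convexI)
    fix q r :: "('a \<times> 'a) \<times> real" and a b :: real
    assume qr: "q \<in> C" "r \<in> C" and ab: "0 \<le> a" "0 \<le> b" "a + b = 1"
    have "u \<bullet> fst (fst (a *\<^sub>R q + b *\<^sub>R r)) + y \<bullet> snd (fst (a *\<^sub>R q + b *\<^sub>R r)) - u \<bullet> y
        \<le> snd (a *\<^sub>R q + b *\<^sub>R r)" if "u \<in> M y" for y u
    proof -
      have "a * (u \<bullet> fst (fst q) + y \<bullet> snd (fst q) - u \<bullet> y)
          + b * (u \<bullet> fst (fst r) + y \<bullet> snd (fst r) - u \<bullet> y) \<le> a * snd q + b * snd r"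
        using that qr ab by (intro add_mono mult_left_mono) (auto simp: C_def)
      moreover have "u \<bullet> y = a * (u \<bullet> y) + b * (u \<bullet> y)"
        using ab by (metis distrib_right mult_1)
      ultimately show ?thesis by (simp add: inner_simps algebra_simps)
    qed
    then show "a *\<^sub>R q + b *\<^sub>R r \<in> C" by (simp add: C_def)
  qed
  moreover have "C \<noteq> {}"
  proof -
    \<comment> \<open>if the graph were empty, every pair would be monotonically related to it, so \<open>(0, 0)\<close>
        would belong to it by maximality\<close>
    have "\<exists>x v. v \<in> M x"
      using maximally_monotone_memI[OF M, of 0 0] by blast
    then show ?thesis using graph_C by blast
  qed
  moreover have "0 \<le> (norm p)\<^sup>2 / 2 + t" if "(p, t) \<in> C" for p t
  proof -
    obtain x v where p: "p = (x, v)" by (cases p)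
    have "0 \<le> (norm (x + v))\<^sup>2 / 2" by simp
    also have "\<dots> = (norm p)\<^sup>2 / 2 + v \<bullet> x"
      unfolding power2_norm_eq_inner p by (simp add: inner_add inner_commute)
    finally show ?thesis using C_ge that p by fastforce
  qed
  ultimately obtain p0 t0 where p0: "(p0, t0) \<in> C"
    and opt: "\<And>p t. (p, t) \<in> C \<Longrightarrow> 0 \<le> p0 \<bullet> (p - p0) + (t - t0)"
    by (rule epigraph_minimiser_exists[of C 0]) metis+
  obtain x v where xv: "p0 = (x, v)" by (cases p0)
  have t0: "v \<bullet> x \<le> t0" using C_ge p0 xv by simp
  \<comment> \<open>the optimality condition at the point \<open>((y, u), u \<bullet> y)\<close> of the epigraph; it makes
      \<open>(- v, - x)\<close> monotonically related to the graph\<close>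
  have key: "(norm (x + v))\<^sup>2 \<le> (u + x) \<bullet> (y + v)" if "u \<in> M y" for y u
    using opt[OF graph_C[OF that]] t0 unfolding xv power2_norm_eq_inner
    by (simp add: inner_simps inner_commute)
  have mem: "- x \<in> M (- v)"
  proof (rule maximally_monotone_memI[OF M])
    fix y u assume "u \<in> M y"
    from key[OF this] show "0 \<le> (u - - x) \<bullet> (y - - v)"
      using order_trans[OF zero_le_power2] by fastforce
  qed
  \<comment> \<open>the right-hand side of \<open>key\<close> vanishes at this pair\<close>
  from key[OF this] have "x + v = 0" by simp
  then have "- v = x" by (simp add: add_eq_0_iff)
  with mem show ?thesis by auto
qed

lemma maximally_monotone_translate:
  assumes "maximally_monotone M"
  shows "maximally_monotone (\<lambda>x. {v. v + z \<in> M x})"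
  unfolding maximally_monotone_iff
proof (intro conjI allI impI)
  show "monotone_operator (\<lambda>x. {v. v + z \<in> M x})"
    using monotone_operatorD[OF maximally_monotone_imp_monotone[OF assms]]
    unfolding monotone_operator_def by fastforce
next
  fix x v assume *: "\<forall>y. \<forall>u\<in>{v. v + z \<in> M y}. 0 \<le> (u - v) \<bullet> (y - x)"
  have "v + z \<in> M x"
  proof (rule maximally_monotone_memI[OF assms])
    fix y u assume "u \<in> M y"
    then show "0 \<le> (u - (v + z)) \<bullet> (y - x)"
      using *[rule_format, of "u - z" y] by (simp add: algebra_simps)
  qed
  then show "v \<in> {v. v + z \<in> M x}" by simp
qed

lemma minty_surjective:
  fixes M :: "'a::{real_inner, complete_space} \<Rightarrow> 'a set"
  assumes "maximally_monotone M"
  shows "\<exists>x. z - x \<in> M x"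
  using minty_zero[OF maximally_monotone_translate[OF assms, of z]] by (simp add: add.commute)

section \<open>Resolvents and reflected resolvents\<close>

lemma resolvent_mem:
  fixes M :: "'a::{real_inner, complete_space} \<Rightarrow> 'a set"
  assumes M: "maximally_monotone M"
  shows "x - resolvent M x \<in> M (resolvent M x)"
proof -
  have iff: "p \<in> inverse_op (id_plus_op M) x \<longleftrightarrow> x - p \<in> M p" for p
    by (force simp: inverse_op_def id_plus_op_def image_iff)
  have "\<exists>!p. x - p \<in> M p"
  proof (rule ex_ex1I[OF minty_surjective[OF M]])
    fix p q assume "x - p \<in> M p" "x - q \<in> M q"
    from monotone_operatorD[OF maximally_monotone_imp_monotone[OF M] this]
    have "(p - q) \<bullet> (p - q) \<le> 0" by (simp add: inner_simps)
    then show "p = q" by (metis inner_eq_zero_iff inner_ge_zero antisym right_minus_eq)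
  qed
  from theI'[OF this] show ?thesis by (simp add: resolvent_def iff)
qed

lemma maximally_monotone_scale:
  assumes M: "maximally_monotone M" and "\<gamma> > 0"
  shows "maximally_monotone (scale_op \<gamma> M)"
  unfolding maximally_monotone_iff
proof (intro conjI allI impI)
  show "monotone_operator (scale_op \<gamma> M)"
    using monotone_operatorD[OF maximally_monotone_imp_monotone[OF M]] \<open>\<gamma> > 0\<close>
    by (auto simp: monotone_operator_def scale_op_def simp flip: scaleR_diff_right)
next
  fix x v assume *: "\<forall>y. \<forall>u\<in>scale_op \<gamma> M y. 0 \<le> (u - v) \<bullet> (y - x)"
  have "v /\<^sub>R \<gamma> \<in> M x"
  proof (rule maximally_monotone_memI[OF M])
    fix y u assume "u \<in> M y"
    then have "0 \<le> (\<gamma> *\<^sub>R u - v) \<bullet> (y - x)" using * by (auto simp: scale_op_def)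
    also have "\<gamma> *\<^sub>R u - v = \<gamma> *\<^sub>R (u - v /\<^sub>R \<gamma>)"
      using \<open>\<gamma> > 0\<close> by (simp add: algebra_simps)
    finally show "0 \<le> (u - v /\<^sub>R \<gamma>) \<bullet> (y - x)"
      using \<open>\<gamma> > 0\<close> by (simp add: zero_le_mult_iff)
  qed
  then show "v \<in> scale_op \<gamma> M x"
    unfolding scale_op_def using \<open>\<gamma> > 0\<close> by (intro image_eqI[where x = "v /\<^sub>R \<gamma>"]) auto
qed

lemma reflected_resolvent_nonexpansive:
  fixes M :: "'a::{real_inner, complete_space} \<Rightarrow> 'a set"
  assumes M: "maximally_monotone M"
  shows "norm (reflected_resolvent M x - reflected_resolvent M y) \<le> norm (x - y)"
proof -
  define p q where "p = resolvent M x" and "q = resolvent M y"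
  have "0 \<le> ((x - p) - (y - q)) \<bullet> (p - q)"
    unfolding p_def q_def
    by (intro monotone_operatorD[OF maximally_monotone_imp_monotone[OF M]] resolvent_mem M)
  moreover have "(norm (x - y))\<^sup>2 - (norm (2 *\<^sub>R p - x - (2 *\<^sub>R q - y)))\<^sup>2
      = 4 * (((x - p) - (y - q)) \<bullet> (p - q))"
    unfolding power2_norm_eq_inner by (simp add: inner_simps inner_commute)
  ultimately have "(norm (2 *\<^sub>R p - x - (2 *\<^sub>R q - y)))\<^sup>2 \<le> (norm (x - y))\<^sup>2" by linarith
  then show ?thesis
    unfolding reflected_resolvent_def p_def[symmetric] q_def[symmetric]
    by (rule power2_le_imp_le) simp
qed

text \<open>The factor on the right is \<open>\<delta>\<close> for \<open>c = \<gamma>\<sigma>\<close> and \<open>L = \<gamma>\<beta>\<close>.\<close>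

lemma norm_diff_le_delta_norm_add:
  fixes p u :: "'a::real_inner"
  assumes "c > 0" and strong: "c * (norm p)\<^sup>2 \<le> u \<bullet> p" and lip: "norm u \<le> L * norm p"
  shows "norm (p - u) \<le> sqrt (1 - 4 * c / (1 + 2 * c + L\<^sup>2)) * norm (p + u)"
proof -
  define D where "D = 1 + 2 * c + L\<^sup>2"
  have "D > 0" using \<open>c > 0\<close> by (simp add: D_def add_pos_nonneg)
  have "(norm u)\<^sup>2 \<le> L\<^sup>2 * (norm p)\<^sup>2"
    using power_mono[OF lip, of 2] by (simp add: power_mult_distrib)
  then have "c * (norm u)\<^sup>2 \<le> c * (L\<^sup>2 * (norm p)\<^sup>2)" using \<open>c > 0\<close> by simp
  moreover have "(1 + L\<^sup>2) * (c * (norm p)\<^sup>2) \<le> (1 + L\<^sup>2) * (u \<bullet> p)"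
    using strong by (intro mult_left_mono) auto
  ultimately have "c * ((norm p)\<^sup>2 + 2 * (u \<bullet> p) + (norm u)\<^sup>2) \<le> D * (u \<bullet> p)"
    unfolding D_def by (simp add: algebra_simps)
  moreover have add: "(norm (p + u))\<^sup>2 = (norm p)\<^sup>2 + 2 * (u \<bullet> p) + (norm u)\<^sup>2"
    unfolding power2_norm_eq_inner by (simp add: inner_simps inner_commute)
  ultimately have "4 * c / D * (norm (p + u))\<^sup>2 \<le> 4 * (u \<bullet> p)"
    using \<open>D > 0\<close> by (simp add: field_simps)
  moreover have "(norm (p - u))\<^sup>2 = (norm (p + u))\<^sup>2 - 4 * (u \<bullet> p)"
    unfolding power2_norm_eq_inner by (simp add: inner_simps inner_commute)
  ultimately have "(norm (p - u))\<^sup>2 \<le> (1 - 4 * c / D) * (norm (p + u))\<^sup>2"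
    by (simp add: algebra_simps)
  then have "sqrt ((norm (p - u))\<^sup>2) \<le> sqrt ((1 - 4 * c / D) * (norm (p + u))\<^sup>2)"
    by (rule real_sqrt_le_mono)
  then show ?thesis by (simp add: real_sqrt_mult D_def)
qed

lemma reflected_resolvent_contraction:
  fixes A :: "'a::{real_inner, complete_space} \<Rightarrow> 'a"
  assumes "\<sigma> > 0" and "\<gamma> > 0"
    and max: "maximally_monotone (single_op A)"
    and strong: "strongly_monotone \<sigma> (single_op A)"
    and lip: "\<beta>-lipschitz_on UNIV A"
  shows "norm (reflected_resolvent (scale_op \<gamma> (single_op A)) x
             - reflected_resolvent (scale_op \<gamma> (single_op A)) y)
         \<le> dr_delta \<sigma> \<beta> \<gamma> * norm (x - y)"
proof -
  define J where "J = resolvent (scale_op \<gamma> (single_op A))"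
  have J: "z = J z + \<gamma> *\<^sub>R A (J z)" for z
    using resolvent_mem[OF maximally_monotone_scale[OF max \<open>\<gamma> > 0\<close>], of z]
    by (simp add: J_def scale_op_def single_op_def algebra_simps)
  define p u where "p = J x - J y" and "u = \<gamma> *\<^sub>R (A (J x) - A (J y))"
  have "\<sigma> * (norm p)\<^sup>2 \<le> (A (J x) - A (J y)) \<bullet> p"
    using strong by (simp add: strongly_monotone_def single_op_def p_def)
  then have 1: "\<gamma> * \<sigma> * (norm p)\<^sup>2 \<le> u \<bullet> p"
    using \<open>\<gamma> > 0\<close> by (simp add: u_def)
  have "norm (A (J x) - A (J y)) \<le> \<beta> * norm p"
    using lipschitz_onD[OF lip, of "J x" "J y"] by (simp add: dist_norm p_def)
  then have 2: "norm u \<le> \<gamma> * \<beta> * norm p"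
    using \<open>\<gamma> > 0\<close> by (simp add: u_def)
  have "x - y = (J x + \<gamma> *\<^sub>R A (J x)) - (J y + \<gamma> *\<^sub>R A (J y))"
    using J[of x] J[of y] by simp
  then have sum: "x - y = p + u"
    by (simp add: p_def u_def algebra_simps)
  have "(2 *\<^sub>R J x - x) - (2 *\<^sub>R J y - y) = 2 *\<^sub>R p - (x - y)"
    by (simp add: p_def algebra_simps)
  also have "\<dots> = p - u" unfolding sum by (simp add: scaleR_2)
  finally have diff: "(2 *\<^sub>R J x - x) - (2 *\<^sub>R J y - y) = p - u" .
  show ?thesis
    using norm_diff_le_delta_norm_add[OF _ 1 2] \<open>\<sigma> > 0\<close> \<open>\<gamma> > 0\<close>
    unfolding reflected_resolvent_def J_def[symmetric] diff sum dr_delta_def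
    by (simp add: mult.assoc)
qed

section \<open>The rate factor\<close>

text \<open>A nonzero vector is needed here: on the trivial space every \<open>\<sigma>\<close> and every
  \<open>\<beta> \<ge> 0\<close> satisfy the other hypotheses.\<close>

lemma strong_monotonicity_le_lipschitz:
  fixes A :: "'a::real_inner \<Rightarrow> 'a"
  assumes "x \<noteq> (0::'a)" "strongly_monotone \<sigma> (single_op A)" "\<beta>-lipschitz_on UNIV A"
  shows "\<sigma> \<le> \<beta>"
proof -
  have "\<sigma> * (norm x)\<^sup>2 \<le> (A x - A 0) \<bullet> x"
    using assms(2) unfolding strongly_monotone_def single_op_def
    by (metis diff_zero singletonI)
  also have "\<dots> \<le> norm (A x - A 0) * norm x" by (rule norm_cauchy_schwarz)
  also have "\<dots> \<le> \<beta> * norm x * norm x"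
    using lipschitz_onD[OF assms(3), of x 0] by (intro mult_right_mono) (auto simp: dist_norm)
  finally show ?thesis using assms(1) by (simp add: power2_eq_square)
qed

lemma dr_delta_bounds:
  assumes "0 < \<sigma>" "\<sigma> \<le> \<beta>" "0 < \<gamma>"
  shows "0 \<le> dr_delta \<sigma> \<beta> \<gamma>" and "dr_delta \<sigma> \<beta> \<gamma> < 1"
proof -
  define D where "D = 1 + 2 * \<gamma> * \<sigma> + (\<gamma> * \<beta>)\<^sup>2"
  have pos: "\<gamma> * \<sigma> > 0" using assms by simp
  then have "D > 0" by (simp add: D_def add_pos_nonneg)
  have "\<gamma> * \<sigma> \<le> \<gamma> * \<beta>" using assms by simp
  moreover have "0 \<le> (1 - \<gamma> * \<beta>)\<^sup>2" by simp
  ultimately have "4 * \<gamma> * \<sigma> \<le> D"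
    unfolding D_def by (simp add: power2_eq_square algebra_simps)
  then show "0 \<le> dr_delta \<sigma> \<beta> \<gamma>"
    using \<open>D > 0\<close> by (simp add: dr_delta_def flip: D_def)
  show "dr_delta \<sigma> \<beta> \<gamma> < 1"
    using \<open>D > 0\<close> pos by (simp add: dr_delta_def flip: D_def)
qed

lemma dr_delta_minimal:
  assumes "0 < \<sigma>" "0 < \<beta>" "0 < \<gamma>" "\<gamma> \<noteq> 1 / \<beta>"
  shows "dr_delta \<sigma> \<beta> (1 / \<beta>) < dr_delta \<sigma> \<beta> \<gamma>"
proof -
  define D where "D = 1 + 2 * \<gamma> * \<sigma> + (\<gamma> * \<beta>)\<^sup>2"
  have "\<gamma> * \<sigma> > 0" using assms by simp
  then have "D > 0" by (simp add: D_def add_pos_nonneg)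
  have "1 - \<gamma> * \<beta> \<noteq> 0" using assms by (auto simp: field_simps)
  then have "0 < (1 - \<gamma> * \<beta>)\<^sup>2" by simp
  then have "\<gamma> * (2 * \<beta> + 2 * \<sigma>) < D"
    unfolding D_def by (simp add: power2_eq_square algebra_simps)
  then have "4 * \<sigma> * (\<gamma> * (2 * \<beta> + 2 * \<sigma>)) < 4 * \<sigma> * D"
    using assms by (intro mult_strict_left_mono) auto
  then have "4 * \<gamma> * \<sigma> / D < 4 * \<sigma> / (2 * \<beta> + 2 * \<sigma>)"
    using \<open>D > 0\<close> assms by (simp add: divide_less_eq less_divide_eq mult.commute mult.left_commute)
  also have "4 * \<sigma> / (2 * \<beta> + 2 * \<sigma>)
      = 4 * (1 / \<beta>) * \<sigma> / (1 + 2 * (1 / \<beta>) * \<sigma> + (1 / \<beta> * \<beta>)\<^sup>2)"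
    using assms by (simp add: divide_simps)
  finally show ?thesis by (simp add: dr_delta_def D_def)
qed

lemma dr_delta_optimal_value:
  assumes "0 < \<sigma>" "0 < \<beta>"
  shows "dr_delta \<sigma> \<beta> (1 / \<beta>) = sqrt ((\<beta> / \<sigma> - 1) / (\<beta> / \<sigma> + 1))"
proof -
  have "1 - 4 * (1 / \<beta>) * \<sigma> / (1 + 2 * (1 / \<beta>) * \<sigma> + (1 / \<beta> * \<beta>)\<^sup>2)
      = (\<beta> - \<sigma>) / (\<beta> + \<sigma>)"
    using assms by (simp add: divide_simps, simp add: algebra_simps)
  also have "\<dots> = (\<beta> / \<sigma> - 1) / (\<beta> / \<sigma> + 1)"
    using assms by (simp add: divide_simps)
  finally show ?thesis by (simp only: dr_delta_def)
qed

lemma dr_rate_bound_in_unit_interval: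
  assumes "0 < \<sigma>" "\<sigma> \<le> \<beta>" "0 < \<gamma>" and \<alpha>: "\<alpha> \<in> {0<..<2 / (1 + dr_delta \<sigma> \<beta> \<gamma>)}"
  shows "0 \<le> dr_rate_bound \<sigma> \<beta> \<alpha> \<gamma>" and "dr_rate_bound \<sigma> \<beta> \<alpha> \<gamma> < 1"
proof -
  note \<delta> = dr_delta_bounds[OF assms(1-3)]
  show "0 \<le> dr_rate_bound \<sigma> \<beta> \<alpha> \<gamma>" using \<delta> \<alpha> by (simp add: dr_rate_bound_def)
  have "\<alpha> * (1 + dr_delta \<sigma> \<beta> \<gamma>) < 2" using \<delta> \<alpha> by (simp add: less_divide_eq)
  moreover have "\<alpha> * dr_delta \<sigma> \<beta> \<gamma> < \<alpha>" using \<delta> \<alpha> by simp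
  ultimately show "dr_rate_bound \<sigma> \<beta> \<alpha> \<gamma> < 1"
    by (simp add: dr_rate_bound_def algebra_simps abs_if)
qed

lemma relaxation_bound:
  fixes a d :: real
  assumes "0 \<le> d" "d < 1" "a \<noteq> 1"
  shows "d < \<bar>1 - a\<bar> + a * d"
proof -
  have "\<bar>1 - a\<bar> * d < \<bar>1 - a\<bar>" using assms by simp
  moreover have "(1 - a) * d \<le> \<bar>1 - a\<bar> * d" using assms by (intro mult_right_mono) auto
  ultimately show ?thesis by (simp add: algebra_simps)
qed

lemma dr_rate_bound_arg_min:
  assumes "0 < \<sigma>" "\<sigma> \<le> \<beta>"
  shows "is_arg_min (\<lambda>(a, g). dr_rate_bound \<sigma> \<beta> a g)
           (\<lambda>(a, g). 0 < g \<and> a \<in> {0<..<2 / (1 + dr_delta \<sigma> \<beta> g)}) (\<alpha>, \<gamma>)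
         \<longleftrightarrow> \<alpha> = 1 \<and> \<gamma> = 1 / \<beta>"
proof -
  have "\<beta> > 0" using assms by simp
  have feasible: "1 \<in> {0<..<2 / (1 + dr_delta \<sigma> \<beta> (1 / \<beta>))}"
    using dr_delta_bounds[OF assms, of "1 / \<beta>"] \<open>\<beta> > 0\<close> by (simp add: less_divide_eq)
  have less: "dr_rate_bound \<sigma> \<beta> 1 (1 / \<beta>) < dr_rate_bound \<sigma> \<beta> a g"
    if "0 < g" "\<not> (a = 1 \<and> g = 1 / \<beta>)" for a g
  proof -
    have *: "dr_delta \<sigma> \<beta> (1 / \<beta>) < dr_delta \<sigma> \<beta> g" if "g \<noteq> 1 / \<beta>"
      using dr_delta_minimal[OF assms(1) \<open>\<beta> > 0\<close> \<open>0 < g\<close> that] .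
    have **: "dr_delta \<sigma> \<beta> g < dr_rate_bound \<sigma> \<beta> a g" if "a \<noteq> 1"
      unfolding dr_rate_bound_def
      using relaxation_bound[OF dr_delta_bounds[OF assms \<open>0 < g\<close>] that] .
    have "dr_rate_bound \<sigma> \<beta> 1 h = dr_delta \<sigma> \<beta> h" for h
      by (simp add: dr_rate_bound_def)
    then show ?thesis
      using * ** that(2) by (cases "a = 1"; cases "g = 1 / \<beta>") (auto intro: less_trans)
  qed
  show ?thesis
    unfolding is_arg_min_def using less feasible \<open>\<beta> > 0\<close>
    by (auto simp del: greaterThanLessThan_iff) (metis less_asym zero_less_divide_1_iff)+
qed

section \<open>Convergence of the iteration\<close>

lemma contraction_converges_with_rate:
  fixes T :: "'a::banach \<Rightarrow> 'a"
  assumes "0 \<le> \<rho>" "\<rho> < 1" and T: "\<And>x y. norm (T x - T y) \<le> \<rho> * norm (x - y)"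
  shows "converges_with_rate T \<rho>"
proof -
  have "\<exists>!z. T z = z"
    using banach_fix_type[OF assms(1,2), of T] T by (simp add: dist_norm)
  moreover have "norm (T x - z) \<le> \<rho> * norm (x - z)" if "T z = z" for x z
    using T[of x z] that by simp
  ultimately show ?thesis using assms by (auto simp: converges_with_rate_def)
qed

lemma douglas_rachford_contraction:
  fixes A :: "'a::{real_inner, complete_space} \<Rightarrow> 'a"
  assumes "\<sigma> > 0" "\<sigma> \<le> \<beta>" "\<gamma> > 0" "\<alpha> > 0"
    and "maximally_monotone (single_op A)" and "maximally_monotone B"
    and "strongly_monotone \<sigma> (single_op A)" and "\<beta>-lipschitz_on UNIV A"
  shows "norm (douglas_rachford \<alpha> \<gamma> (single_op A) B x - douglas_rachford \<alpha> \<gamma> (single_op A) B y)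
         \<le> dr_rate_bound \<sigma> \<beta> \<alpha> \<gamma> * norm (x - y)"
proof -
  define RA where "RA = reflected_resolvent (scale_op \<gamma> (single_op A))"
  define RB where "RB = reflected_resolvent (scale_op \<gamma> B)"
  let ?\<delta> = "dr_delta \<sigma> \<beta> \<gamma>"
  have "norm (RA (RB x) - RA (RB y)) \<le> ?\<delta> * norm (RB x - RB y)"
    unfolding RA_def using assms by (intro reflected_resolvent_contraction)
  also have "\<dots> \<le> ?\<delta> * norm (x - y)"
    unfolding RB_def using assms
    by (intro mult_left_mono reflected_resolvent_nonexpansive maximally_monotone_scale
          dr_delta_bounds)
  finally have R: "norm (RA (RB x) - RA (RB y)) \<le> ?\<delta> * norm (x - y)" .
  have "norm (((1 - \<alpha>) *\<^sub>R x + \<alpha> *\<^sub>R RA (RB x)) - ((1 - \<alpha>) *\<^sub>R y + \<alpha> *\<^sub>R RA (RB y)))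
      = norm ((1 - \<alpha>) *\<^sub>R (x - y) + \<alpha> *\<^sub>R (RA (RB x) - RA (RB y)))"
    by (simp add: algebra_simps)
  also have "\<dots> \<le> \<bar>1 - \<alpha>\<bar> * norm (x - y) + \<alpha> * norm (RA (RB x) - RA (RB y))"
    using \<open>\<alpha> > 0\<close> by (metis abs_of_pos norm_scaleR norm_triangle_ineq)
  also have "\<dots> \<le> \<bar>1 - \<alpha>\<bar> * norm (x - y) + \<alpha> * (?\<delta> * norm (x - y))"
    using R \<open>\<alpha> > 0\<close> by simp
  finally show ?thesis
    by (simp add: douglas_rachford_def RA_def RB_def dr_rate_bound_def algebra_simps)
qed

theorem theorem6p5:
  fixes A :: "'a::{real_inner, banach, second_countable_topology} \<Rightarrow> 'a"
    and B :: "'a \<Rightarrow> 'a set"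
    and \<sigma> \<beta> :: real
  assumes "\<exists>x::'a. x \<noteq> 0"
    and "\<sigma> > 0" and "\<beta> > 0"
    and "maximally_monotone (single_op A)"
    and "maximally_monotone B"
    and "strongly_monotone \<sigma> (single_op A)"
    and "\<beta>-lipschitz_on UNIV A"
  shows "(\<forall>\<gamma>>0. \<forall>\<alpha>\<in>{0<..<2 / (1 + dr_delta \<sigma> \<beta> \<gamma>)}.
            converges_with_rate (douglas_rachford \<alpha> \<gamma> (single_op A) B) (dr_rate_bound \<sigma> \<beta> \<alpha> \<gamma>))
       \<and> (\<forall>\<alpha> \<gamma>. is_arg_min (\<lambda>(a, g). dr_rate_bound \<sigma> \<beta> a g)
                  (\<lambda>(a, g). 0 < g \<and> a \<in> {0<..<2 / (1 + dr_delta \<sigma> \<beta> g)}) (\<alpha>, \<gamma>)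
               \<longleftrightarrow> \<alpha> = 1 \<and> \<gamma> = 1 / \<beta>)
       \<and> dr_rate_bound \<sigma> \<beta> 1 (1 / \<beta>) = sqrt ((\<beta> / \<sigma> - 1) / (\<beta> / \<sigma> + 1))"
proof -
  obtain x0 :: 'a where "x0 \<noteq> 0" using assms(1) by blast
  then have le: "\<sigma> \<le> \<beta>" using assms(6,7) by (rule strong_monotonicity_le_lipschitz)
  have "converges_with_rate (douglas_rachford \<alpha> \<gamma> (single_op A) B) (dr_rate_bound \<sigma> \<beta> \<alpha> \<gamma>)"
    if \<gamma>: "\<gamma> > 0" and \<alpha>: "\<alpha> \<in> {0<..<2 / (1 + dr_delta \<sigma> \<beta> \<gamma>)}" for \<alpha> \<gamma>
  proof (rule contraction_converges_with_rate)
    show "0 \<le> dr_rate_bound \<sigma> \<beta> \<alpha> \<gamma>" "dr_rate_bound \<sigma> \<beta> \<alpha> \<gamma> < 1"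
      using dr_rate_bound_in_unit_interval[OF assms(2) le \<gamma> \<alpha>] by auto
    have "\<alpha> > 0" using \<alpha> by simp
    then show "norm (douglas_rachford \<alpha> \<gamma> (single_op A) B x
          - douglas_rachford \<alpha> \<gamma> (single_op A) B y) \<le> dr_rate_bound \<sigma> \<beta> \<alpha> \<gamma> * norm (x - y)"
      for x y
      by (rule douglas_rachford_contraction[OF assms(2) le \<gamma> _ assms(4-7)])
  qed
  moreover have "dr_rate_bound \<sigma> \<beta> 1 (1 / \<beta>) = sqrt ((\<beta> / \<sigma> - 1) / (\<beta> / \<sigma> + 1))"
    using dr_delta_optimal_value[OF assms(2,3)] by (simp add: dr_rate_bound_def)
  ultimately show ?thesis
    using dr_rate_bound_arg_min[OF assms(2) le] by blast
qed

end
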